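(* Let $(G,d)$ be a $p$-uniformly convex metric space with constant $c>0$. Let $D\subseteq G$ and $T:D\to D$, and suppose $S:=\operatorname{Fix}T\cap D$ is nonempty. Suppose all sequences $(x_k)_{k\in\mathbb N}$ defined by $x_{k+1}=Tx_k$ and initialized in $D$ are gauge monotone relative to $S$ with rate $\theta$, where $\theta:[0,\infty)\to[0,\infty)$ satisfies $\theta(0)=0$, $0<\theta(t)<t$ for all $t>0$, and $\sum_{j=1}^\infty\theta^{(j)}(t)<\infty$ for all $t\ge0$. Suppose, in addition, that $(\mathrm{Id}-\theta)^{-1}$ is continuous on $[0,\infty)$, strictly increasing, and $(\mathrm{Id}-\theta)^{-1}(0)=0$. Then the function $$\mathcal T_S(x):=\left(\tfrac2c\inf_{y\in S}\psi_T^{(p,c)}(x,y)\right)^{1/p}$$ is metrically subregular for $0$ relative to $D$ on $D$ with gauge $\rho=(\mathrm{Id}-\theta)^{-1}$.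
   Context: Let $p\in(1,\infty)$. A metric space $(G,d)$ is $p$-uniformly convex with constant $c>0$ if it is a geodesic space and for all $x,y,z\in G$, $t\in[0,1]$: $$d(z,(1-t)x\oplus ty)^p\le(1-t)d(z,x)^p+td(z,y)^p-\tfrac c2t(1-t)d(x,y)^p,$$ where $(1-t)x\oplus ty$ is the point on the (unique) geodesic joining $x$ and $y$ at distance $t\,d(x,y)$ from $x$. $\operatorname{Fix}T=\{x:Tx=x\}$; $d(x,S)=\inf_{z\in S}d(x,z)$. $\psi_T^{(p,c)}(x,y)=\tfrac c2\left(d(Tx,x)^p+d(Ty,y)^p+d(Tx,Ty)^p+d(x,y)^p-d(Tx,y)^p-d(x,Ty)^p\right)$. A sequence $(x_k)$ is gauge monotone relative to $S$ with rate $\theta$ (where $\theta:[0,\infty)\to[0,\infty)$ is continuous, strictly increasing, $\theta(0)=0$, $\theta(t)\le t$) if $d(x_{k+1},S)\le\theta(d(x_k,S))$ for all $k\in\mathbb N$. $\theta^{(j)}$ is the $j$-fold composition. $(\mathrm{Id}-\theta)^{-1}$ is the inverse function of $t\mapsto t-\theta(t)$ on $[0,\infty)$ (assumed to exist). A function $\mathcal T:D\to[0,\infty]$ is metrically subregular for $0$ relative to $D$ on $D$ with gauge $\rho$ if $d(x,\mathcal T^{-1}(0)\cap D)\le\rho(\mathcal T(x))$ for all $x\in D$ with $\rho(\mathcal T(x))>0$. *)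

theory Defs
  imports "HOL-Analysis.Analysis"
begin

text \<open>Geodesics are parametrised proportionally to arc length on the unit interval, so the point
  \<open>(1 - t) x \<oplus> t y\<close> is the value at \<open>t\<close> of the geodesic joining \<open>x\<close> and \<open>y\<close>.\<close>

definition geodesic_path :: "'a::metric_space set \<Rightarrow> 'a \<Rightarrow> 'a \<Rightarrow> (real \<Rightarrow> 'a) \<Rightarrow> bool" where
  "geodesic_path G x y \<gamma> \<longleftrightarrow>
     \<gamma> \<in> {0..1} \<rightarrow> G \<and> \<gamma> 0 = x \<and> \<gamma> 1 = y \<and>
     (\<forall>s\<in>{0..1}. \<forall>t\<in>{0..1}. dist (\<gamma> s) (\<gamma> t) = \<bar>s - t\<bar> * dist x y)"

definition geodesic_space :: "'a::metric_space set \<Rightarrow> bool" where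
  "geodesic_space G \<longleftrightarrow> (\<forall>x\<in>G. \<forall>y\<in>G. \<exists>\<gamma>. geodesic_path G x y \<gamma>)"

text \<open>For \<open>p > 1\<close> and \<open>c > 0\<close>, uniqueness of the geodesic between two points is a consequence of
  the inequality. It is therefore not required separately, and the inequality is stated
  for every geodesic from \<open>x\<close> to \<open>y\<close>.\<close>

definition p_uniformly_convex :: "'a::metric_space set \<Rightarrow> real \<Rightarrow> real \<Rightarrow> bool" where
  "p_uniformly_convex G p c \<longleftrightarrow>
     geodesic_space G \<and>
     (\<forall>x\<in>G. \<forall>y\<in>G. \<forall>z\<in>G. \<forall>\<gamma>. geodesic_path G x y \<gamma> \<longrightarrow>
        (\<forall>t\<in>{0..1}. dist z (\<gamma> t) powr p
           \<le> (1 - t) * dist z x powr p + t * dist z y powr p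
             - c / 2 * t * (1 - t) * dist x y powr p))"

definition Fix :: "('a \<Rightarrow> 'a) \<Rightarrow> 'a set" where
  "Fix T = {x. T x = x}"

definition psi :: "real \<Rightarrow> real \<Rightarrow> ('a::metric_space \<Rightarrow> 'a) \<Rightarrow> 'a \<Rightarrow> 'a \<Rightarrow> real" where
  "psi p c T x y =
     c / 2 * (dist (T x) x powr p + dist (T y) y powr p + dist (T x) (T y) powr p
              + dist x y powr p - dist (T x) y powr p - dist x (T y) powr p)"

definition rate_function :: "(real \<Rightarrow> real) \<Rightarrow> bool" where
  "rate_function \<theta> \<longleftrightarrow>
     \<theta> \<in> {0..} \<rightarrow> {0..} \<and> continuous_on {0..} \<theta> \<and> strict_mono_on {0..} \<theta> \<and>
     \<theta> 0 = 0 \<and> (\<forall>t\<ge>0. \<theta> t \<le> t)"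

definition gauge_monotone ::
    "'a::metric_space set \<Rightarrow> (real \<Rightarrow> real) \<Rightarrow> (nat \<Rightarrow> 'a) \<Rightarrow> bool" where
  "gauge_monotone S \<theta> x \<longleftrightarrow>
     rate_function \<theta> \<and> (\<forall>k. infdist (x (Suc k)) S \<le> \<theta> (infdist (x k) S))"

definition Id_minus_inv :: "(real \<Rightarrow> real) \<Rightarrow> real \<Rightarrow> real" where
  "Id_minus_inv \<theta> = the_inv_into {0..} (\<lambda>t. t - \<theta> t)"

text \<open>Since \<open>\<rho>\<close> is only given on \<open>[0, \<infinity>)\<close>, points with \<open>\<T> x = \<infinity>\<close> impose no condition.
  The nonemptiness conjunct is needed because \<open>infdist x {} = 0\<close>, whereas the distance to the
  empty set is \<open>\<infinity>\<close>.\<close>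

definition metrically_subregular ::
    "('a::metric_space \<Rightarrow> ennreal) \<Rightarrow> 'a set \<Rightarrow> (real \<Rightarrow> real) \<Rightarrow> bool" where
  "metrically_subregular \<T> D \<rho> \<longleftrightarrow>
     (\<forall>x\<in>D. \<T> x < \<infinity> \<and> \<rho> (enn2real (\<T> x)) > 0 \<longrightarrow>
        \<T> -` {0} \<inter> D \<noteq> {} \<and> infdist x (\<T> -` {0} \<inter> D) \<le> \<rho> (enn2real (\<T> x)))"

text \<open>On \<open>S \<subseteq> Fix T\<close> the infimum is over nonnegative reals, so for nonempty \<open>S\<close> the real-valued
  infimum agrees with the extended one.\<close>

definition surrogate ::
    "real \<Rightarrow> real \<Rightarrow> ('a::metric_space \<Rightarrow> 'a) \<Rightarrow> 'a set \<Rightarrow> 'a \<Rightarrow> ennreal" where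
  "surrogate p c T S x = ennreal ((2 / c * (INF y\<in>S. psi p c T x y)) powr (1 / p))"

end

theory Submission
  imports Defs
begin

text \<open>Against a fixed point, \<open>psi\<close> loses its dependence on \<open>y\<close> and
  reduces to a multiple of the displacement power. Hence the surrogate is the displacement
  \<open>dist (T x) x\<close> (\<open>surrogate_Fix_eq\<close>), and its zeros in \<open>D\<close>
  form \<open>S\<close>. With d = \<open>infdist x S\<close>, gauge monotonicity and the triangle
  inequality give d - \<theta>(d) \<le> d - \<open>infdist (T x) S\<close> \<le>
  \<open>dist x (T x)\<close>. Applying the increasing inverse of Id - \<theta> bounds d
  (\<open>infdist_le_Id_minus_inv\<close>).\<close>

text \<open>Once \<open>T y = y\<close>, the second term is \<open>0 powr p = 0\<close> and the four
  terms mixing \<open>x\<close> and \<open>y\<close> cancel in pairs.\<close>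

lemma psi_Fix:
  assumes "y \<in> Fix T"
  shows "psi p c T x y = c / 2 * dist (T x) x powr p"
  using assms by (simp add: psi_def Fix_def)

lemma surrogate_Fix_eq:
  assumes "0 < p" "0 < c" "S \<subseteq> Fix T" "S \<noteq> {}"
  shows "surrogate p c T S x = ennreal (dist (T x) x)"
proof -
  have "(INF y\<in>S. psi p c T x y) = (INF y\<in>S. c / 2 * dist (T x) x powr p)"
    using assms(3) by (intro INF_cong) (auto simp: psi_Fix)
  \<comment> \<open>A constant family has that constant as its real infimum only over a nonempty
    index set.\<close>
  also have "\<dots> = c / 2 * dist (T x) x powr p"
    using assms(4) by simp
  finally have "2 / c * (INF y\<in>S. psi p c T x y) = dist (T x) x powr p"
    using assms(2) by (simp add: field_simps)
  then show ?thesis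
    using assms(1) by (simp only: surrogate_def powr_powr) simp
qed

lemma Id_minus_inv_eq:
  assumes "inj_on (\<lambda>t. t - \<theta> t) {0..}" "0 \<le> t"
  shows "Id_minus_inv \<theta> (t - \<theta> t) = t"
  using the_inv_into_f_f[OF assms(1), of t] assms(2) by (simp add: Id_minus_inv_def)

text \<open>One step of the error bound, with \<open>y\<close> in the role of
  \<open>T x\<close>.\<close>

lemma infdist_le_Id_minus_inv:
  assumes "infdist y S \<le> \<theta> (infdist x S)"
    and "bij_betw (\<lambda>t. t - \<theta> t) {0..} {0..}"
    and "mono_on {0..} (Id_minus_inv \<theta>)"
  shows "infdist x S \<le> Id_minus_inv \<theta> (dist x y)"
proof -
  let ?d = "infdist x S"
  \<comment> \<open>The bijection maps into \<open>{0..}\<close>, so this value lies where the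
    inverse is known to be monotone.\<close>
  have nonneg: "0 \<le> ?d - \<theta> ?d"
    using bij_betwE[OF assms(2)] infdist_nonneg[of x S] by auto
  have "?d - \<theta> ?d \<le> dist x y"
    using infdist_triangle[of x S y] assms(1) by linarith
  then have "Id_minus_inv \<theta> (?d - \<theta> ?d) \<le> Id_minus_inv \<theta> (dist x y)"
    using nonneg by (intro mono_onD[OF assms(3)]) auto
  then show ?thesis
    using Id_minus_inv_eq[of \<theta> ?d] bij_betw_imp_inj_on[OF assms(2)] infdist_nonneg[of x S] by simp
qed

theorem theorem32:
  fixes G D S :: "'a::metric_space set" and p c :: real
    and T :: "'a \<Rightarrow> 'a" and \<theta> :: "real \<Rightarrow> real"
  assumes "1 < p" and "0 < c"
    and "p_uniformly_convex G p c"
    and "D \<subseteq> G" and "T \<in> D \<rightarrow> D"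
    and "S = Fix T \<inter> D" and "S \<noteq> {}"
    and "\<And>x :: nat \<Rightarrow> 'a. x 0 \<in> D \<Longrightarrow> (\<And>k. x (Suc k) = T (x k)) \<Longrightarrow> gauge_monotone S \<theta> x"
    and "\<theta> 0 = 0" and "\<And>t. 0 < t \<Longrightarrow> 0 < \<theta> t \<and> \<theta> t < t"
    and "\<And>t. 0 \<le> t \<Longrightarrow> summable (\<lambda>j. (\<theta> ^^ Suc j) t)"
    and "bij_betw (\<lambda>t. t - \<theta> t) {0..} {0..}"
    and "continuous_on {0..} (Id_minus_inv \<theta>)"
    and "strict_mono_on {0..} (Id_minus_inv \<theta>)"
    and "Id_minus_inv \<theta> 0 = 0"
  shows "metrically_subregular (surrogate p c T S) D (Id_minus_inv \<theta>)"
proof -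
  have surrogate: "surrogate p c T S x = ennreal (dist (T x) x)" for x
    using assms(1,2,6,7) by (intro surrogate_Fix_eq) auto
  have zeros: "surrogate p c T S -` {0} \<inter> D = S"
    unfolding vimage_def surrogate using assms(6) by (auto simp: Fix_def)
  have "infdist x S \<le> Id_minus_inv \<theta> (dist x (T x))" if "x \<in> D" for x
  proof (rule infdist_le_Id_minus_inv)
    \<comment> \<open>The orbit of \<open>x\<close> is the test sequence; its index 0 compares
      \<open>T x\<close> with \<open>x\<close>.\<close>
    have "gauge_monotone S \<theta> (\<lambda>k. (T ^^ k) x)"
      using that by (intro assms(8)) auto
    then show "infdist (T x) S \<le> \<theta> (infdist x S)"
      unfolding gauge_monotone_def by (auto dest: spec[of _ 0])
  qed (use assms(12,14) strict_mono_on_imp_mono_on in auto)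
  then show ?thesis
    using assms(7) unfolding metrically_subregular_def zeros
    by (simp add: surrogate dist_commute)
qed

end
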